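(* Let $\varepsilon>0$ and $c(x,y)=|x-y|^2$. Let $X\subseteq\mathbb{R}$ be the closure of a bounded open set with $\mathrm{diam}(X)>\sqrt{2\varepsilon}$. Then the Sinkhorn divergence $S_\varepsilon$ is not jointly convex over $\mathcal{P}(X)\times\mathcal{P}(X)$.
   Context: $\mathcal{P}(X)$: Borel probability measures on $X$. $\mathrm{OT}_\varepsilon(\mu,\nu)=\inf_{\pi\in\Pi(\mu,\nu)}\iint c\,d\pi+\varepsilon\,\mathrm{KL}(\pi\,|\,\mu\otimes\nu)$, where $\Pi(\mu,\nu)$ is the set of couplings of $\mu,\nu$ and $\mathrm{KL}$ is the Kullback--Leibler divergence. Sinkhorn divergence: $S_\varepsilon(\mu,\nu)=\mathrm{OT}_\varepsilon(\mu,\nu)-\frac12\mathrm{OT}_\varepsilon(\mu,\mu)-\frac12\mathrm{OT}_\varepsilon(\nu,\nu)$. Joint convexity means convexity of $(\mu,\nu)\mapsto S_\varepsilon(\mu,\nu)$ on the convex set $\mathcal{P}(X)\times\mathcal{P}(X)$. *)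

theory Defs
  imports "HOL-Probability.Probability"
begin

definition borel_prob_measures :: "'a::topological_space set \<Rightarrow> 'a measure set" where
  "borel_prob_measures X = {\<mu>. prob_space \<mu> \<and> sets \<mu> = sets (restrict_space borel X)}"

definition couplings :: "'a measure \<Rightarrow> 'b measure \<Rightarrow> ('a \<times> 'b) measure set" where
  "couplings \<mu> \<nu> =
     {\<pi>. sets \<pi> = sets (\<mu> \<Otimes>\<^sub>M \<nu>) \<and> distr \<pi> \<mu> fst = \<mu> \<and> distr \<pi> \<nu> snd = \<nu>}"

text \<open>
  The divergence of \<open>\<pi>\<close> relative to \<open>\<rho>\<close>, with values in the extended reals; note that the
  library's \<^const>\<open>KL_divergence\<close> takes the reference measure first. It is a Bochner
  integral, hence has a junk value outside the guarded case. For finite \<open>\<rho>\<close> the negative part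
  of the log-density is always \<open>\<pi>\<close>-integrable, so failure of integrability
  means that the integral is infinite.
\<close>

definition KL :: "'a measure \<Rightarrow> 'a measure \<Rightarrow> ereal" where
  "KL \<pi> \<rho> =
     (if absolutely_continuous \<rho> \<pi> \<and> integrable \<pi> (entropy_density (exp 1) \<rho> \<pi>)
      then ereal (KL_divergence (exp 1) \<rho> \<pi>) else \<infinity>)"

text \<open>
  The cost is nonnegative, so \<open>OT\<close> is meaningful without integrability side conditions. For a
  bounded measurable cost, probability marginals and \<open>\<epsilon> > 0\<close> it is finite, as the product coupling
  has divergence 0 and divergences between probability measures are nonnegative; hence no
  subtraction of infinities occurs in \<open>sinkhorn_divergence\<close> below in that case.
\<close>

definition OT :: "('a \<Rightarrow> 'b \<Rightarrow> ennreal) \<Rightarrow> real \<Rightarrow> 'a measure \<Rightarrow> 'b measure \<Rightarrow> ereal" where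
  "OT c \<epsilon> \<mu> \<nu> =
     (INF \<pi>\<in>couplings \<mu> \<nu>.
        enn2ereal (\<integral>\<^sup>+ (x, y). c x y \<partial>\<pi>) + ereal \<epsilon> * KL \<pi> (\<mu> \<Otimes>\<^sub>M \<nu>))"

definition sinkhorn_divergence ::
  "('a \<Rightarrow> 'a \<Rightarrow> ennreal) \<Rightarrow> real \<Rightarrow> 'a measure \<Rightarrow> 'a measure \<Rightarrow> ereal" where
  "sinkhorn_divergence c \<epsilon> \<mu> \<nu> =
     OT c \<epsilon> \<mu> \<nu> - ereal (1/2) * OT c \<epsilon> \<mu> \<mu> - ereal (1/2) * OT c \<epsilon> \<nu> \<nu>"

text \<open>The convex combination \<open>(1 - t) \<mu> + t \<nu>\<close> of two measures on the same measurable space.\<close>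

definition mix_measure :: "real \<Rightarrow> 'a measure \<Rightarrow> 'a measure \<Rightarrow> 'a measure" where
  "mix_measure t \<mu> \<nu> =
     measure_of (space \<mu>) (sets \<mu>) (\<lambda>A. ennreal (1 - t) * emeasure \<mu> A + ennreal t * emeasure \<nu> A)"

lemma sets_mix_measure [simp]: "sets (mix_measure t \<mu> \<nu>) = sets \<mu>"
  by (simp add: mix_measure_def)

lemma space_mix_measure [simp]: "space (mix_measure t \<mu> \<nu>) = space \<mu>"
  by (simp add: mix_measure_def)

lemma emeasure_mix_measure:
  assumes [simp]: "sets \<nu> = sets \<mu>" and A: "A \<in> sets \<mu>"
  shows "emeasure (mix_measure t \<mu> \<nu>) A = ennreal (1 - t) * emeasure \<mu> A + ennreal t * emeasure \<nu> A"
proof (rule emeasure_measure_of[OF mix_measure_def])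
  show "sets \<mu> \<subseteq> Pow (space \<mu>)"
    by (rule sets.space_closed)
  show "positive (sets (mix_measure t \<mu> \<nu>)) (\<lambda>A. ennreal (1 - t) * emeasure \<mu> A + ennreal t * emeasure \<nu> A)"
    by (simp add: positive_def)
  show "countably_additive (sets (mix_measure t \<mu> \<nu>)) (\<lambda>A. ennreal (1 - t) * emeasure \<mu> A + ennreal t * emeasure \<nu> A)"
  proof (rule countably_additiveI)
    fix B :: "nat \<Rightarrow> 'a set"
    assume B: "range B \<subseteq> sets (mix_measure t \<mu> \<nu>)" "disjoint_family B"
    have "(\<Sum>i. emeasure \<mu> (B i)) = emeasure \<mu> (\<Union>i. B i)" "(\<Sum>i. emeasure \<nu> (B i)) = emeasure \<nu> (\<Union>i. B i)"
      using B by (auto intro!: suminf_emeasure)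
    then show "(\<Sum>i. ennreal (1 - t) * emeasure \<mu> (B i) + ennreal t * emeasure \<nu> (B i)) =
        ennreal (1 - t) * emeasure \<mu> (\<Union>i. B i) + ennreal t * emeasure \<nu> (\<Union>i. B i)"
      by (simp add: suminf_add[symmetric] ennreal_suminf_cmult)
  qed
  show "A \<in> sets (mix_measure t \<mu> \<nu>)"
    using A by simp
qed

lemma mix_measure_in_borel_prob_measures:
  assumes "\<mu> \<in> borel_prob_measures X" "\<nu> \<in> borel_prob_measures X" "t \<in> {0..1}"
  shows "mix_measure t \<mu> \<nu> \<in> borel_prob_measures X"
proof -
  have s: "sets \<nu> = sets \<mu>" and p: "prob_space \<mu>" "prob_space \<nu>"
    using assms by (auto simp: borel_prob_measures_def)
  have "space \<nu> = space \<mu>"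
    using s by (rule sets_eq_imp_space_eq)
  then have "emeasure (mix_measure t \<mu> \<nu>) (space \<mu>) = ennreal (1 - t) + ennreal t"
    using p[THEN prob_space.emeasure_space_1] s by (simp add: emeasure_mix_measure)
  also have "\<dots> = 1"
    using assms(3) by (simp flip: ennreal_plus)
  finally have "prob_space (mix_measure t \<mu> \<nu>)"
    by (intro prob_spaceI) simp
  then show ?thesis
    using assms by (simp add: borel_prob_measures_def)
qed

definition jointly_convex_on ::
  "'a measure set \<Rightarrow> ('a measure \<Rightarrow> 'a measure \<Rightarrow> ereal) \<Rightarrow> bool" where
  "jointly_convex_on P F \<longleftrightarrow>
     (\<forall>\<mu>\<^sub>0\<in>P. \<forall>\<nu>\<^sub>0\<in>P. \<forall>\<mu>\<^sub>1\<in>P. \<forall>\<nu>\<^sub>1\<in>P. \<forall>t\<in>{0..1}.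
        F (mix_measure t \<mu>\<^sub>0 \<mu>\<^sub>1) (mix_measure t \<nu>\<^sub>0 \<nu>\<^sub>1)
          \<le> ereal (1 - t) * F \<mu>\<^sub>0 \<nu>\<^sub>0 + ereal t * F \<mu>\<^sub>1 \<nu>\<^sub>1)"

end

theory Submission
  imports Defs
begin

text \<open>
  For uniform measures on \<open>{a, b}\<close> and \<open>{p, q}\<close> the optimal coupling is the Gibbs coupling, with
  density proportional to \<open>exp (2 (x - m) (y - n) / \<epsilon>)\<close> where \<open>m\<close>, \<open>n\<close> are the two means; the matching lower
  bound is the Donsker--Varadhan inequality. This gives \<open>OT\<close> in closed form.
  Now choose \<open>a, b \<in> X\<close> with \<open>b - a > sqrt (2 \<epsilon>)\<close> and \<open>c \<in> X\<close> close to, but different from, \<open>a\<close>, and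
  consider the midpoint of the Dirac pairs \<open>(\<delta>\<^sub>a, \<delta>\<^sub>c)\<close> and \<open>(\<delta>\<^sub>b, \<delta>\<^sub>b)\<close>. With \<open>x = (b - a) / sqrt (2 \<epsilon>)\<close>
  and \<open>y = (b - c) / sqrt (2 \<epsilon>)\<close>, convexity would force
  \<open>ln (1 + exp (- 2 x\<^sup>2)) + ln (1 + exp (- 2 y\<^sup>2)) \<le> 2 ln (1 + exp (- 2 x y))\<close>, which fails
  for distinct \<open>x, y > 1\<close>.
\<close>

section \<open>The Donsker--Varadhan inequality\<close>

text \<open>This is \<open>1 + t \<le> exp t\<close> at \<open>t = \<phi> - c - ln L\<close>,
  multiplied by \<open>L\<close>; for \<open>L = 0\<close> the right side vanishes and the left side
  is negative.\<close>

lemma exp_minus_tangent_le: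
  fixes L \<phi> c :: real
  assumes "0 \<le> L"
  shows "L - exp (\<phi> - c) \<le> L * (ln L - \<phi> + c)"
proof (cases "L = 0")
  case False
  with assms have L: "0 < L"
    by simp
  have "L * (1 + (\<phi> - c - ln L)) \<le> L * exp (\<phi> - c - ln L)"
    by (rule mult_left_mono[OF exp_ge_add_one_self assms])
  also have "\<dots> = exp (\<phi> - c)"
    using L by (simp add: exp_diff)
  finally show ?thesis
    by (simp add: algebra_simps)
qed simp

text \<open>Let \<open>L\<close> be the density of \<open>\<pi>\<close> and \<open>c\<close> the
  logarithm of the integral of \<open>exp \<phi>\<close>. Both \<open>L\<close> and
  \<open>exp (\<phi> - c)\<close> have \<open>\<rho>\<close>-integral 1, so integrating the tangent
  inequality leaves 0 on its left side. This bounds the transport cost from below for all couplings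
  at once.\<close>

lemma Donsker_Varadhan_le:
  fixes \<phi> :: "'a \<Rightarrow> real"
  assumes \<rho>: "prob_space \<rho>" and \<pi>: "prob_space \<pi>" and sets: "sets \<pi> = sets \<rho>"
    and ac: "absolutely_continuous \<rho> \<pi>"
    and int: "integrable \<pi> (entropy_density (exp 1) \<rho> \<pi>)"
    and \<phi>: "integrable \<pi> \<phi>" and e\<phi>: "integrable \<rho> (\<lambda>z. exp (\<phi> z))"
    and Z: "0 < (\<integral>z. exp (\<phi> z) \<partial>\<rho>)"
  shows "(\<integral>z. \<phi> z \<partial>\<pi>) - ln (\<integral>z. exp (\<phi> z) \<partial>\<rho>) \<le> KL_divergence (exp 1) \<rho> \<pi>"
proof -
  interpret \<rho>: prob_space \<rho> by fact
  interpret \<pi>: prob_space \<pi> by fact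
  define L where "L z = enn2real (RN_deriv \<rho> \<pi> z)" for z
  define c where "c = ln (\<integral>z. exp (\<phi> z) \<partial>\<rho>)"
  have [measurable]: "L \<in> borel_measurable \<rho>"
    unfolding L_def by measurable
  \<comment> \<open>The derivative is finite almost everywhere, so passing to the reals by
    \<open>enn2real\<close> loses nothing.\<close>
  have "AE z in \<rho>. RN_deriv \<rho> \<pi> z \<noteq> \<infinity>"
    by (rule \<rho>.RN_deriv_finite) (use ac sets in \<open>auto intro: \<pi>.sigma_finite_measure_axioms\<close>)
  then have "density \<rho> (RN_deriv \<rho> \<pi>) = density \<rho> L"
    by (intro density_cong) (auto simp: L_def less_top)
  then have dens: "\<pi> = density \<rho> L"
    using \<rho>.density_RN_deriv[OF ac sets] by simp
  have meas: "f \<in> borel_measurable \<pi> \<longleftrightarrow> f \<in> borel_measurable \<rho>" for f :: "'a \<Rightarrow> real"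
    using measurable_cong_sets[OF sets refl] by blast
  have L0: "AE z in \<rho>. 0 \<le> L z"
    by (simp add: L_def)
  have ed: "entropy_density (exp 1) \<rho> \<pi> = (\<lambda>z. ln (L z))"
    by (simp add: entropy_density_def L_def comp_def log_def)
  have [measurable]: "\<phi> \<in> borel_measurable \<rho>"
    using \<phi> meas by auto
  have lhs: "integrable \<pi> (\<lambda>z. ln (L z) - \<phi> z + c)"
    using int \<phi> by (simp add: ed)
  have to_\<rho>: "integrable \<pi> f \<longleftrightarrow> integrable \<rho> (\<lambda>z. L z * f z)"
    "integral\<^sup>L \<pi> f = (\<integral>z. L z * f z \<partial>\<rho>)" if "f \<in> borel_measurable \<rho>" for f :: "'a \<Rightarrow> real"
    using that by (subst dens; simp add: integrable_density integral_density L0)+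
  have L: "integrable \<rho> L" "(\<integral>z. L z \<partial>\<rho>) = 1"
    using to_\<rho>[of "\<lambda>_. 1"] by (auto simp: \<pi>.prob_space)
  have e: "integrable \<rho> (\<lambda>z. exp (\<phi> z - c))" "(\<integral>z. exp (\<phi> z - c) \<partial>\<rho>) = 1"
    using e\<phi> Z by (auto simp: exp_diff c_def)
  have "0 = (\<integral>z. L z - exp (\<phi> z - c) \<partial>\<rho>)"
    using L e by simp
  also have "\<dots> \<le> (\<integral>z. L z * (ln (L z) - \<phi> z + c) \<partial>\<rho>)"
  proof (rule integral_mono)
    show "integrable \<rho> (\<lambda>z. L z * (ln (L z) - \<phi> z + c))"
      using lhs by (subst (asm) to_\<rho>) auto
    show "integrable \<rho> (\<lambda>z. L z - exp (\<phi> z - c))"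
      using L e by simp
    show "L z - exp (\<phi> z - c) \<le> L z * (ln (L z) - \<phi> z + c)" for z
      by (rule exp_minus_tangent_le) (simp add: L_def)
  qed
  also have "\<dots> = (\<integral>z. ln (L z) - \<phi> z + c \<partial>\<pi>)"
    by (subst to_\<rho>) auto
  also have "\<dots> = KL_divergence (exp 1) \<rho> \<pi> - (\<integral>z. \<phi> z \<partial>\<pi>) + c"
    using int \<phi> by (simp add: ed KL_divergence_def \<pi>.prob_space)
  finally show ?thesis
    by (simp add: c_def)
qed

text \<open>By uniqueness, \<open>w\<close> agrees almost everywhere with the Radon-Nikodym
  derivative. This evaluates the divergence of the Gibbs coupling, whose log-density is
  explicit.\<close>

lemma KL_density_eq:
  fixes w :: "'a \<Rightarrow> real"
  assumes \<rho>: "prob_space \<rho>" and w[measurable]: "w \<in> borel_measurable \<rho>" and w0: "\<And>z. 0 < w z"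
    and int: "integrable (density \<rho> w) (\<lambda>z. ln (w z))"
  shows "KL (density \<rho> w) \<rho> = ereal (\<integral>z. ln (w z) \<partial>density \<rho> w)"
proof -
  interpret \<rho>: prob_space \<rho> by fact
  have "AE z in \<rho>. ennreal (w z) = RN_deriv \<rho> (density \<rho> w) z"
    by (rule \<rho>.RN_deriv_unique) auto
  then have "AE z in \<rho>. ln (w z) = entropy_density (exp 1) \<rho> (density \<rho> w) z"
  proof eventually_elim
    case (elim z)
    then show ?case
      using w0[of z] by (simp add: entropy_density_def log_def less_imp_le flip: elim)
  qed
  then have ae: "AE z in density \<rho> w. entropy_density (exp 1) \<rho> (density \<rho> w) z = ln (w z)"
    by (subst AE_density) (auto elim: eventually_mono)
  have "integrable (density \<rho> w) (entropy_density (exp 1) \<rho> (density \<rho> w))"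
    by (subst integrable_cong_AE[OF _ _ ae]) (use int in auto)
  moreover have "absolutely_continuous \<rho> (density \<rho> w)"
    by (rule absolutely_continuousI_density) simp
  moreover have "KL_divergence (exp 1) \<rho> (density \<rho> w) = (\<integral>z. ln (w z) \<partial>density \<rho> w)"
    unfolding KL_divergence_def by (rule integral_cong_AE[OF _ _ ae]) auto
  ultimately show ?thesis
    by (simp add: KL_def)
qed

section \<open>Uniform measures on two points\<close>

text \<open>The points may coincide, in which case this is a Dirac measure.\<close>

definition two_point :: "'a measure \<Rightarrow> 'a \<Rightarrow> 'a \<Rightarrow> 'a measure" where
  "two_point M a b = distr (measure_pmf (bernoulli_pmf (1/2))) M (\<lambda>i. if i then a else b)"

lemma sets_two_point [simp, measurable_cong]: "sets (two_point M a b) = sets M"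
  by (simp add: two_point_def)

lemma space_two_point [simp]: "space (two_point M a b) = space M"
  by (simp add: two_point_def)

lemma prob_space_two_point:
  assumes "a \<in> space M" "b \<in> space M"
  shows "prob_space (two_point M a b)"
  unfolding two_point_def
  by (intro measure_pmf.prob_space_distr) (use assms in auto)

lemma nn_integral_two_point:
  assumes "a \<in> space M" "b \<in> space M" "f \<in> borel_measurable M"
  shows "(\<integral>\<^sup>+x. f x \<partial>two_point M a b) = ennreal (1/2) * f a + ennreal (1/2) * f b"
  using assms unfolding two_point_def
  by (subst nn_integral_distr) (auto simp: mult.commute)

lemma integral_two_point:
  fixes f :: "'a \<Rightarrow> real"
  assumes "a \<in> space M" "b \<in> space M" "f \<in> borel_measurable M"
  shows "integrable (two_point M a b) f" "(\<integral>x. f x \<partial>two_point M a b) = (f a + f b) / 2"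
  using assms unfolding two_point_def
  by (auto simp: integrable_distr_eq integral_distr field_simps intro!: integrable_measure_pmf_finite)

lemma emeasure_two_point:
  assumes "a \<in> space M" "b \<in> space M" "A \<in> sets M"
  shows "emeasure (two_point M a b) A = ennreal (1/2) * indicator A a + ennreal (1/2) * indicator A b"
  using nn_integral_two_point[of a M b "indicator A"] assms by simp

text \<open>Midpoints of Dirac measures stay in the two-point family, so one closed form for
  \<open>OT\<close> serves both sides of the convexity inequality.\<close>

lemma mix_two_point:
  assumes "a \<in> space M" "b \<in> space M"
  shows "mix_measure (1/2) (two_point M a a) (two_point M b b) = two_point M a b"
proof (rule measure_eqI)
  fix A assume "A \<in> sets (mix_measure (1/2) (two_point M a a) (two_point M b b))"
  moreover have "ennreal (1/2) * i + ennreal (1/2) * i = i" for i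
    by (simp only: flip: distrib_right) (simp flip: ennreal_plus del: ennreal_half)
  ultimately show "emeasure (mix_measure (1/2) (two_point M a a) (two_point M b b)) A = emeasure (two_point M a b) A"
    using assms by (simp add: emeasure_mix_measure emeasure_two_point)
qed simp

lemma nn_integral_two_point_pair:
  assumes "a \<in> space M" "b \<in> space M" "p \<in> space N" "q \<in> space N"
    and f[measurable]: "f \<in> borel_measurable (M \<Otimes>\<^sub>M N)"
  shows "(\<integral>\<^sup>+z. f z \<partial>(two_point M a b \<Otimes>\<^sub>M two_point N p q)) =
    ennreal (1/2) * (ennreal (1/2) * f (a, p) + ennreal (1/2) * f (a, q)) +
    ennreal (1/2) * (ennreal (1/2) * f (b, p) + ennreal (1/2) * f (b, q))"
proof -
  interpret prob_space "two_point N p q"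
    by (rule prob_space_two_point) fact+
  have "(\<integral>\<^sup>+z. f z \<partial>(two_point M a b \<Otimes>\<^sub>M two_point N p q)) =
      (\<integral>\<^sup>+x. \<integral>\<^sup>+y. f (x, y) \<partial>two_point N p q \<partial>two_point M a b)"
    by (rule nn_integral_fst[symmetric]) measurable
  then show ?thesis
    using assms by (simp add: nn_integral_two_point)
qed

lemma integral_two_point_pair:
  fixes f :: "'a \<times> 'b \<Rightarrow> real"
  assumes pts: "a \<in> space M" "b \<in> space M" "p \<in> space N" "q \<in> space N"
    and f[measurable]: "f \<in> borel_measurable (M \<Otimes>\<^sub>M N)"
  shows "integrable (two_point M a b \<Otimes>\<^sub>M two_point N p q) f"
    "(\<integral>z. f z \<partial>(two_point M a b \<Otimes>\<^sub>M two_point N p q)) =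
      (f (a, p) + f (a, q) + f (b, p) + f (b, q)) / 4"
proof -
  interpret P: prob_space "two_point M a b" by (rule prob_space_two_point) fact+
  interpret Q: prob_space "two_point N p q" by (rule prob_space_two_point) fact+
  interpret PQ: pair_sigma_finite "two_point M a b" "two_point N p q" ..
  show int: "integrable (two_point M a b \<Otimes>\<^sub>M two_point N p q) f"
  proof (rule integrableI_bounded)
    have "(\<integral>\<^sup>+z. ennreal (norm (f z)) \<partial>(two_point M a b \<Otimes>\<^sub>M two_point N p q)) =
      ennreal (1/2) * (ennreal (1/2) * ennreal (norm (f (a, p))) + ennreal (1/2) * ennreal (norm (f (a, q)))) +
      ennreal (1/2) * (ennreal (1/2) * ennreal (norm (f (b, p))) + ennreal (1/2) * ennreal (norm (f (b, q))))"
      by (rule nn_integral_two_point_pair) (use pts in measurable)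
    also have "\<dots> < \<infinity>"
      using ennreal_less_top[of "1/2"] by (simp add: ennreal_mult_less_top)
    finally show "(\<integral>\<^sup>+z. ennreal (norm (f z)) \<partial>(two_point M a b \<Otimes>\<^sub>M two_point N p q)) < \<infinity>" .
  qed measurable
  have "(\<integral>z. f z \<partial>(two_point M a b \<Otimes>\<^sub>M two_point N p q)) =
      (\<integral>x. \<integral>y. f (x, y) \<partial>two_point N p q \<partial>two_point M a b)"
    by (rule PQ.integral_fst'[symmetric, OF int])
  also have "\<dots> = (\<integral>x. (f (x, p) + f (x, q)) / 2 \<partial>two_point M a b)"
    by (intro Bochner_Integration.integral_cong) (auto simp: integral_two_point pts)
  also have "\<dots> = (f (a, p) + f (a, q) + f (b, p) + f (b, q)) / 4"
    using pts by (subst integral_two_point) (auto simp: field_simps)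
  finally show "(\<integral>z. f z \<partial>(two_point M a b \<Otimes>\<^sub>M two_point N p q)) =
      (f (a, p) + f (a, q) + f (b, p) + f (b, q)) / 4" .
qed


section \<open>Quadratic entropic transport between two-point measures\<close>

text \<open>
  With \<open>m\<close> and \<open>n\<close> the centres of the two measures, the cost plus \<open>2 (x - m) (y - n)\<close> is a sum of a
  function of \<open>x\<close> and a function of \<open>y\<close>, so its integral is the same for all couplings.
\<close>

lemma OT_two_point:
  fixes M N :: "real measure"
  assumes \<epsilon>: "0 < \<epsilon>"
    and M[measurable]: "(\<lambda>x. x) \<in> borel_measurable M" and N[measurable]: "(\<lambda>x. x) \<in> borel_measurable N"
    and pts: "a \<in> space M" "b \<in> space M" "p \<in> space N" "q \<in> space N"
  shows "OT (\<lambda>x y. ennreal (\<bar>x - y\<bar>\<^sup>2)) \<epsilon> (two_point M a b) (two_point N p q) =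
    ereal (((a + b) / 2 - (p + q) / 2)\<^sup>2 + (b - a)\<^sup>2 / 4 + (q - p)\<^sup>2 / 4
      - \<epsilon> * ln (cosh ((b - a) * (q - p) / (2 * \<epsilon>))))"
    (is "OT ?c \<epsilon> ?\<mu> ?\<nu> = ereal (?K - \<epsilon> * ln ?Z)")
proof -
  define m n where "m = (a + b) / 2" and "n = (p + q) / 2"
  define \<rho> where "\<rho> = ?\<mu> \<Otimes>\<^sub>M ?\<nu>"
  define s where "s = (b - a) * (q - p) / (2 * \<epsilon>)"
  define Z where "Z = cosh s"
  define \<phi> where "\<phi> z = 2 * (fst z - m) * (snd z - n) / \<epsilon>" for z
  \<comment> \<open>\<open>f\<close> and \<open>g\<close> come from expanding the square of
    \<open>(x - m) - (y - n) + (m - n)\<close>; the constant term is put into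
    \<open>f\<close>.\<close>
  define f where "f x = (x - m)\<^sup>2 + 2 * (x - m) * (m - n) + (m - n)\<^sup>2" for x
  define g where "g y = (y - n)\<^sup>2 - 2 * (m - n) * (y - n)" for y
  interpret P: prob_space ?\<mu> by (rule prob_space_two_point) fact+
  interpret Q: prob_space ?\<nu> by (rule prob_space_two_point) fact+
  interpret PQ: pair_prob_space ?\<mu> ?\<nu> ..
  have \<rho>: "prob_space \<rho>"
    unfolding \<rho>_def by (rule PQ.prob_space_axioms)
  have [measurable_cong]: "sets \<rho> = sets (M \<Otimes>\<^sub>M N)"
    unfolding \<rho>_def by (intro sets_pair_measure_cong) auto
  have fst_snd[measurable]: "fst \<in> borel_measurable (M \<Otimes>\<^sub>M N)" "snd \<in> borel_measurable (M \<Otimes>\<^sub>M N)"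
    using measurable_compose[OF measurable_fst M] measurable_compose[OF measurable_snd N] by auto
  have [measurable]: "\<phi> \<in> borel_measurable (M \<Otimes>\<^sub>M N)"
    unfolding \<phi>_def by measurable
  \<comment> \<open>Each pair of points is symmetric about its centre, so \<open>\<phi>\<close> is
    \<open>s\<close> on two of the four combinations and \<open>- s\<close> on the other two; its
    exponential therefore averages to \<open>cosh s\<close>.\<close>
  have \<phi>_pts: "\<phi> (a, p) = s" "\<phi> (a, q) = - s" "\<phi> (b, p) = - s" "\<phi> (b, q) = s"
    using \<epsilon> by (simp_all add: \<phi>_def s_def m_def n_def field_simps)
  have cost_eq: "\<bar>fst z - snd z\<bar>\<^sup>2 = f (fst z) + g (snd z) - \<epsilon> * \<phi> z" for z
  proof -
    have "\<epsilon> * \<phi> z = 2 * (fst z - m) * (snd z - n)"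
      using \<epsilon> by (simp add: \<phi>_def)
    then show ?thesis
      by (simp add: f_def g_def power2_eq_square algebra_simps)
  qed
  have Z: "0 < Z"
    by (simp add: Z_def cosh_real_pos)
  have e\<phi>: "integrable \<rho> (\<lambda>z. exp (\<phi> z))" "(\<integral>z. exp (\<phi> z) \<partial>\<rho>) = Z"
    using integral_two_point_pair[of a M b p N q "\<lambda>z. exp (\<phi> z)"] pts
    by (simp_all add: \<rho>_def \<phi>_pts Z_def cosh_field_def)

  have coupling: "prob_space \<pi>" "integrable \<pi> \<phi>"
      "enn2ereal (\<integral>\<^sup>+(x, y). ?c x y \<partial>\<pi>) = ereal (?K - \<epsilon> * (\<integral>z. \<phi> z \<partial>\<pi>))"
    if "\<pi> \<in> couplings ?\<mu> ?\<nu>" for \<pi>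
  proof -
    have [measurable_cong]: "sets \<pi> = sets (M \<Otimes>\<^sub>M N)"
      using that sets_pair_measure_cong[of ?\<mu> M ?\<nu> N] by (simp add: couplings_def)
    have marg: "distr \<pi> ?\<mu> fst = ?\<mu>" "distr \<pi> ?\<nu> snd = ?\<nu>"
      using that by (auto simp: couplings_def)
    have fst[measurable]: "fst \<in> measurable \<pi> ?\<mu>" and snd[measurable]: "snd \<in> measurable \<pi> ?\<nu>"
      by measurable
    \<comment> \<open>\<open>couplings\<close> does not ask for total mass 1; it is inherited from
      the first marginal.\<close>
    show "prob_space \<pi>"
      using P.prob_space_axioms marg(1) by (intro prob_space_distrD[OF fst]) simp
    have int1: "integrable \<pi> (\<lambda>z. h (fst z))" "(\<integral>z. h (fst z) \<partial>\<pi>) = (h a + h b) / 2"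
      if [measurable]: "h \<in> borel_measurable M" for h :: "real \<Rightarrow> real"
    proof -
      have "integrable (distr \<pi> ?\<mu> fst) h" "(\<integral>z. h z \<partial>distr \<pi> ?\<mu> fst) = (h a + h b) / 2"
        unfolding marg using pts by (simp_all only: integral_two_point that)
      then show "integrable \<pi> (\<lambda>z. h (fst z))" "(\<integral>z. h (fst z) \<partial>\<pi>) = (h a + h b) / 2"
        by (auto intro: integrable_distr[OF fst] simp: integral_distr[OF fst])
    qed
    have int2: "integrable \<pi> (\<lambda>z. h (snd z))" "(\<integral>z. h (snd z) \<partial>\<pi>) = (h p + h q) / 2"
      if [measurable]: "h \<in> borel_measurable N" for h :: "real \<Rightarrow> real"
    proof -
      have "integrable (distr \<pi> ?\<nu> snd) h" "(\<integral>z. h z \<partial>distr \<pi> ?\<nu> snd) = (h p + h q) / 2"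
        unfolding marg using pts by (simp_all only: integral_two_point that)
      then show "integrable \<pi> (\<lambda>z. h (snd z))" "(\<integral>z. h (snd z) \<partial>\<pi>) = (h p + h q) / 2"
        by (auto intro: integrable_distr[OF snd] simp: integral_distr[OF snd])
    qed
    have [measurable]: "f \<in> borel_measurable M" "g \<in> borel_measurable N"
      unfolding f_def g_def by measurable
    \<comment> \<open>The product is dominated by the sum of squares, which involves the marginals
      only.\<close>
    show \<phi>: "integrable \<pi> \<phi>"
    proof (rule Bochner_Integration.integrable_bound)
      show "integrable \<pi> (\<lambda>z. ((fst z - m)\<^sup>2 + (snd z - n)\<^sup>2) / \<epsilon>)"
        using int1(1)[of "\<lambda>x. (x - m)\<^sup>2"] int2(1)[of "\<lambda>y. (y - n)\<^sup>2"] by simp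
      have bound: "\<bar>2 * x * y\<bar> \<le> x\<^sup>2 + y\<^sup>2" for x y :: real
        using sum_squares_bound[of "\<bar>x\<bar>" "\<bar>y\<bar>"] by (simp add: abs_mult)
      show "AE z in \<pi>. norm (\<phi> z) \<le> norm (((fst z - m)\<^sup>2 + (snd z - n)\<^sup>2) / \<epsilon>)"
      proof (rule AE_I2)
        fix z
        have "norm (\<phi> z) = \<bar>2 * (fst z - m) * (snd z - n)\<bar> / \<epsilon>"
          using \<epsilon> by (simp add: \<phi>_def)
        also have "\<dots> \<le> ((fst z - m)\<^sup>2 + (snd z - n)\<^sup>2) / \<epsilon>"
          using \<epsilon> by (intro divide_right_mono bound) auto
        also have "\<dots> \<le> norm (((fst z - m)\<^sup>2 + (snd z - n)\<^sup>2) / \<epsilon>)"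
          using \<epsilon> by simp
        finally show "norm (\<phi> z) \<le> norm (((fst z - m)\<^sup>2 + (snd z - n)\<^sup>2) / \<epsilon>)" .
      qed
    qed measurable
    have K1: "integrable \<pi> (\<lambda>z. f (fst z) + g (snd z) - \<epsilon> * \<phi> z)"
      using int1(1)[of f] int2(1)[of g] \<phi> by simp
    have "(\<integral>z. f (fst z) + g (snd z) - \<epsilon> * \<phi> z \<partial>\<pi>) =
        (\<integral>z. f (fst z) \<partial>\<pi>) + (\<integral>z. g (snd z) \<partial>\<pi>) - \<epsilon> * (\<integral>z. \<phi> z \<partial>\<pi>)"
      using int1(1)[of f] int2(1)[of g] \<phi> by simp
    also have "(\<integral>z. f (fst z) \<partial>\<pi>) + (\<integral>z. g (snd z) \<partial>\<pi>) = (f a + f b) / 2 + (g p + g q) / 2"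
      by (simp only: int1(2)[of f] int2(2)[of g] \<open>f \<in> borel_measurable M\<close> \<open>g \<in> borel_measurable N\<close>)
    \<comment> \<open>The terms linear in \<open>x - m\<close> and \<open>y - n\<close> average to
      zero; the squares give the two variances.\<close>
    also have "\<dots> = ?K"
      by (simp add: f_def g_def m_def n_def power2_eq_square field_simps)
    finally have K2: "(\<integral>z. f (fst z) + g (snd z) - \<epsilon> * \<phi> z \<partial>\<pi>) = ?K - \<epsilon> * (\<integral>z. \<phi> z \<partial>\<pi>)" .
    have nonneg: "0 \<le> f (fst z) + g (snd z) - \<epsilon> * \<phi> z" for z
      by (simp flip: cost_eq)
    have "(\<integral>\<^sup>+(x, y). ?c x y \<partial>\<pi>) = (\<integral>\<^sup>+z. ennreal (f (fst z) + g (snd z) - \<epsilon> * \<phi> z) \<partial>\<pi>)"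
      by (intro nn_integral_cong) (simp add: case_prod_beta flip: cost_eq)
    also have "\<dots> = ennreal (\<integral>z. f (fst z) + g (snd z) - \<epsilon> * \<phi> z \<partial>\<pi>)"
      by (intro nn_integral_eq_integral K1 AE_I2 nonneg)
    finally have cost: "(\<integral>\<^sup>+(x, y). ?c x y \<partial>\<pi>) = ennreal (\<integral>z. f (fst z) + g (snd z) - \<epsilon> * \<phi> z \<partial>\<pi>)" .
    show "enn2ereal (\<integral>\<^sup>+(x, y). ?c x y \<partial>\<pi>) = ereal (?K - \<epsilon> * (\<integral>z. \<phi> z \<partial>\<pi>))"
      unfolding cost K2[symmetric] by (intro enn2ereal_ennreal Bochner_Integration.integral_nonneg nonneg)
  qed

  \<comment> \<open>Lower bound: \<open>\<epsilon>\<close> times the Donsker-Varadhan inequality for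
    \<open>\<phi>\<close> cancels the integral of \<open>\<phi>\<close> in the cost. Infinite
    divergence is trivial since \<open>\<epsilon> > 0\<close>.\<close>
  have "ereal (?K - \<epsilon> * ln Z) \<le> enn2ereal (\<integral>\<^sup>+(x, y). ?c x y \<partial>\<pi>) + ereal \<epsilon> * KL \<pi> \<rho>"
    if \<pi>: "\<pi> \<in> couplings ?\<mu> ?\<nu>" for \<pi>
  proof (cases "absolutely_continuous \<rho> \<pi> \<and> integrable \<pi> (entropy_density (exp 1) \<rho> \<pi>)")
    case True
    have "(\<integral>z. \<phi> z \<partial>\<pi>) - ln Z \<le> KL_divergence (exp 1) \<rho> \<pi>"
      using Donsker_Varadhan_le[of \<rho> \<pi> \<phi>] \<rho> coupling[OF \<pi>] True e\<phi> Z \<pi>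
      by (auto simp: couplings_def \<rho>_def)
    then have "\<epsilon> * ((\<integral>z. \<phi> z \<partial>\<pi>) - ln Z) \<le> \<epsilon> * KL_divergence (exp 1) \<rho> \<pi>"
      using \<epsilon> by (intro mult_left_mono) auto
    then show ?thesis
      using True unfolding coupling(3)[OF \<pi>] by (simp add: KL_def algebra_simps)
  next
    case False
    then have "KL \<pi> \<rho> = \<infinity>"
      by (simp only: KL_def if_False)
    then show ?thesis
      using \<epsilon> unfolding coupling(3)[OF \<pi>] by simp
  qed
  then have lower: "ereal (?K - \<epsilon> * ln Z) \<le> OT ?c \<epsilon> ?\<mu> ?\<nu>"
    unfolding OT_def \<rho>_def by (intro INF_greatest)

  \<comment> \<open>Upper bound: the Gibbs density, for which the preceding bound is
    attained.\<close>
  define w where "w z = exp (\<phi> z) / Z" for z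
  define H where "H = ennreal (1/2)"
  have [measurable]: "w \<in> borel_measurable (M \<Otimes>\<^sub>M N)"
    unfolding w_def by measurable
  have w0: "0 < w z" for z
    using Z by (simp add: w_def)
  have w_pts: "w (a, p) = exp s / Z" "w (a, q) = exp (- s) / Z" "w (b, p) = exp (- s) / Z" "w (b, q) = exp s / Z"
    by (simp_all add: w_def \<phi>_pts)
  \<comment> \<open>Fixing either coordinate, the density takes the values \<open>exp s / Z\<close>
    and \<open>exp (- s) / Z\<close>, in some order. Their average is 1, so both marginals are
    preserved.\<close>
  have "H * ennreal (exp s / Z) + H * ennreal (exp (- s) / Z) = ennreal (1/2 * (exp s / Z) + 1/2 * (exp (- s) / Z))"
    unfolding H_def by (subst ennreal_plus) (use Z in simp, use Z in simp, simp only: ennreal_mult')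
  also have "1/2 * (exp s / Z) + 1/2 * (exp (- s) / Z) = 1"
    using Z by (simp add: field_simps) (simp add: Z_def cosh_field_def)
  finally have w_sum: "H * ennreal (exp s / Z) + H * ennreal (exp (- s) / Z) = 1"
    by simp
  let ?\<pi> = "density \<rho> w"
  have \<pi>: "?\<pi> \<in> couplings ?\<mu> ?\<nu>"
    unfolding couplings_def mem_Collect_eq
  proof (intro conjI measure_eqI)
    show "sets ?\<pi> = sets (?\<mu> \<Otimes>\<^sub>M ?\<nu>)"
      by (simp add: \<rho>_def)
  next
    fix A assume "A \<in> sets (distr ?\<pi> ?\<mu> fst)"
    then have [measurable]: "A \<in> sets M"
      by simp
    have "emeasure (distr ?\<pi> ?\<mu> fst) A = (\<integral>\<^sup>+z. ennreal (w z) * indicator A (fst z) \<partial>\<rho>)"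
      by (subst nn_integral_indicator[symmetric], simp, subst nn_integral_distr, measurable, subst nn_integral_density) auto
    also have "\<dots> = H * (H * (ennreal (w (a, p)) * indicator A a) + H * (ennreal (w (a, q)) * indicator A a)) +
        H * (H * (ennreal (w (b, p)) * indicator A b) + H * (ennreal (w (b, q)) * indicator A b))"
      unfolding \<rho>_def H_def using pts by (subst nn_integral_two_point_pair) auto
    also have "\<dots> = emeasure ?\<mu> A"
      unfolding w_pts emeasure_two_point[OF pts(1,2) \<open>A \<in> sets M\<close>] H_def[symmetric]
      using w_sum by (auto simp: add.commute indicator_def)
    finally show "emeasure (distr ?\<pi> ?\<mu> fst) A = emeasure ?\<mu> A" .
  next
    fix A assume "A \<in> sets (distr ?\<pi> ?\<nu> snd)"
    then have [measurable]: "A \<in> sets N"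
      by simp
    have "emeasure (distr ?\<pi> ?\<nu> snd) A = (\<integral>\<^sup>+z. ennreal (w z) * indicator A (snd z) \<partial>\<rho>)"
      by (subst nn_integral_indicator[symmetric], simp, subst nn_integral_distr, measurable, subst nn_integral_density) auto
    also have "\<dots> = H * (H * (ennreal (w (a, p)) * indicator A p) + H * (ennreal (w (a, q)) * indicator A q)) +
        H * (H * (ennreal (w (b, p)) * indicator A p) + H * (ennreal (w (b, q)) * indicator A q))"
      unfolding \<rho>_def H_def using pts by (subst nn_integral_two_point_pair) auto
    also have "\<dots> = H * ((H * ennreal (w (a, p)) + H * ennreal (w (b, p))) * indicator A p) + H * ((H * ennreal (w (a, q)) + H * ennreal (w (b, q))) * indicator A q)"
      by (simp add: algebra_simps)
    also have "\<dots> = emeasure ?\<nu> A"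
      unfolding w_pts emeasure_two_point[OF pts(3,4) \<open>A \<in> sets N\<close>] H_def[symmetric]
      using w_sum by (auto simp: add.commute)
    finally show "emeasure (distr ?\<pi> ?\<nu> snd) A = emeasure ?\<nu> A" .
  qed auto
  interpret \<pi>: prob_space ?\<pi>
    by (rule coupling(1)[OF \<pi>])
  have ln_w: "ln (w z) = \<phi> z - ln Z" for z
    using Z by (simp add: w_def ln_div)
  have "KL ?\<pi> \<rho> = ereal ((\<integral>z. \<phi> z \<partial>?\<pi>) - ln Z)"
    using coupling(2)[OF \<pi>] by (subst KL_density_eq) (auto simp: \<rho> w0 ln_w \<pi>.prob_space[simplified])
  then have "enn2ereal (\<integral>\<^sup>+(x, y). ?c x y \<partial>?\<pi>) + ereal \<epsilon> * KL ?\<pi> (?\<mu> \<Otimes>\<^sub>M ?\<nu>) = ereal (?K - \<epsilon> * ln Z)"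
    unfolding coupling(3)[OF \<pi>] by (simp add: algebra_simps flip: \<rho>_def)
  then have "OT ?c \<epsilon> ?\<mu> ?\<nu> \<le> ereal (?K - \<epsilon> * ln Z)"
    unfolding OT_def by (metis (no_types, lifting) INF_lower \<pi>)
  with lower show ?thesis
    by (simp add: Z_def s_def)
qed

section \<open>Failure of convexity\<close>

text \<open>The numerator of the derivative is \<open>1 - (2 * x - 1) * exp (2 * x)\<close>,
  negative for \<open>x \<ge> 1\<close>. The diameter hypothesis serves to reach this range.\<close>

lemma logistic_slope_strict_antimono:
  fixes u v :: real
  assumes "1 \<le> u" "u < v"
  shows "v / (1 + exp (2 * v)) < u / (1 + exp (2 * u))"
proof (rule DERIV_neg_imp_decreasing[OF \<open>u < v\<close>])
  fix x assume "u \<le> x" "x \<le> v"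
  then have x: "1 \<le> x"
    using assms by simp
  have ne: "1 + exp (2 * x) \<noteq> 0"
    using exp_gt_zero[of "2 * x"] by linarith
  have "1 < exp (2 * x)"
    using x by simp
  also have "\<dots> \<le> (2 * x - 1) * exp (2 * x)"
    using x by simp
  finally have "(1 + exp (2 * x) - x * (2 * exp (2 * x))) / (1 + exp (2 * x))\<^sup>2 < 0"
    using ne by (intro divide_neg_pos) (simp add: algebra_simps, simp)
  moreover have "((\<lambda>v. v / (1 + exp (2 * v))) has_real_derivative
      (1 + exp (2 * x) - x * (2 * exp (2 * x))) / (1 + exp (2 * x))\<^sup>2) (at x)"
    by (rule derivative_eq_intros refl ne | simp add: power2_eq_square)+
  ultimately show "\<exists>y. ((\<lambda>v. v / (1 + exp (2 * v))) has_real_derivative y) (at x) \<and> y < 0"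
    by blast
qed

text \<open>Strict convexity of \<open>w \<mapsto> ln (1 + exp (- 2 e\<^sup>w))\<close> on the half line \<open>w \<ge> 0\<close>.\<close>

lemma ln_one_plus_exp_geometric_mean:
  fixes x y :: real
  assumes x: "1 \<le> x" and y: "x < y"
  shows "2 * ln (1 + exp (- 2 * (x * y))) < ln (1 + exp (- 2 * x\<^sup>2)) + ln (1 + exp (- 2 * y\<^sup>2))"
proof -
  \<comment> \<open>The points \<open>2 * ln x\<close>, \<open>ln x + ln y\<close>,
    \<open>2 * ln y\<close> are equally spaced with gap \<open>l\<close>. The mean value theorem on
    both halves compares slopes \<open>F'\<close>, which increase because
    \<open>exp w \<ge> 1\<close> there.\<close>
  define F where "F w = ln (1 + exp (- 2 * exp w))" for w :: real
  define F' where "F' w = - 2 * (exp w / (1 + exp (2 * exp w)))" for w :: real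
  define l where "l = ln y - ln x"
  have F: "(F has_real_derivative F' w) (at w)" for w
    unfolding F_def F'_def using exp_gt_zero[of "2 * exp w"] exp_gt_zero[of "- (2 * exp w)"]
    by (auto intro!: derivative_eq_intros simp: field_simps exp_minus add_pos_pos)
  have l: "0 < l"
    using x y by (simp add: l_def)
  obtain z1 where z1: "2 * ln x < z1" "z1 < 2 * ln x + l" "F (2 * ln x + l) - F (2 * ln x) = l * F' z1"
    using MVT2[of "2 * ln x" "2 * ln x + l" F F'] F l by auto
  obtain z2 where z2: "2 * ln x + l < z2" "F (2 * ln y) - F (2 * ln x + l) = l * F' z2"
    using MVT2[of "2 * ln x + l" "2 * ln y" F F'] F l by (auto simp: l_def)
  have "1 \<le> exp z1"
    using z1(1) ln_ge_zero[OF x] by simp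
  then have "F' z1 < F' z2"
    using logistic_slope_strict_antimono[of "exp z1" "exp z2"] z1 z2 by (simp add: F'_def)
  then have "l * F' z1 < l * F' z2"
    using l by simp
  then have "2 * F (2 * ln x + l) < F (2 * ln x) + F (2 * ln y)"
    using z1(3) z2(2) by linarith
  moreover have "exp (2 * ln x) = x\<^sup>2" "exp (2 * ln y) = y\<^sup>2" "exp (2 * ln x + l) = x * y"
    using x y by (simp_all add: l_def exp_add exp_diff exp_double power2_eq_square)
  ultimately show ?thesis
    unfolding F_def by simp
qed

theorem theorem7p4:
  fixes \<epsilon> :: real and X U :: "real set"
  assumes "\<epsilon> > 0"
    and "open U" and "bounded U" and "X = closure U"
    and "diameter X > sqrt (2 * \<epsilon>)"
  shows "\<not> jointly_convex_on (borel_prob_measures X)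
           (sinkhorn_divergence (\<lambda>x y. ennreal (\<bar>x - y\<bar>\<^sup>2)) \<epsilon>)"
proof
  let ?r = "sqrt (2 * \<epsilon>)"
  let ?S = "sinkhorn_divergence (\<lambda>x y. ennreal (\<bar>x - y\<bar>\<^sup>2)) \<epsilon>"
  assume conv: "jointly_convex_on (borel_prob_measures X) ?S"
  have r: "0 < ?r"
    using assms(1) by simp
  have "bounded X"
    using assms by (simp add: bounded_closure)
  then obtain a b where ab: "a \<in> X" "b \<in> X" "?r < b - a"
    using diameter_lower_bounded[of X ?r] r assms(5) by (auto simp: dist_real_def abs_if split: if_splits)
  \<comment> \<open>Since \<open>a\<close> lies in the closure of \<open>U\<close>, the half line
    below \<open>b - ?r\<close> meets \<open>U\<close> in a nonempty open set. Such a set is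
    infinite, hence contains a point other than \<open>a\<close>.\<close>
  have "\<exists>c\<in>X. c \<noteq> a \<and> ?r < b - c"
  proof -
    define W where "W = U \<inter> {..<b - ?r}"
    have "a \<in> closure U" "open {..<b - ?r}" "a \<in> {..<b - ?r}"
      using ab assms(4) by auto
    then have "W \<noteq> {}"
      unfolding W_def by (metis closure_iff_nhds_not_empty order_refl inf_commute)
    moreover have "open W"
      using assms(2) by (auto simp: W_def)
    ultimately have "infinite W"
      using finite_imp_not_open by blast
    then obtain c where "c \<in> W" "c \<noteq> a"
      by (metis finite.emptyI finite_insert finite_subset insertCI subsetI)
    then show ?thesis
      using closure_subset[of U] assms(4) by (auto simp: W_def)
  qed
  then obtain c where c: "c \<in> X" "c \<noteq> a" "?r < b - c"
    by blast

  define M where "M = restrict_space borel X"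
  have [simp]: "space M = X" and id: "(\<lambda>x. x) \<in> borel_measurable M"
    by (auto simp: M_def space_restrict_space intro: measurable_restrict_space1)
  \<comment> \<open>The variance terms of \<open>OT\<close> cancel against the two self-transport
    terms, leaving the squared distance of the means and the \<open>ln cosh\<close> terms.\<close>
  have S: "?S (two_point M u v) (two_point M p q) =
      ereal (((u + v) / 2 - (p + q) / 2)\<^sup>2 - \<epsilon> * ln (cosh ((v - u) * (q - p) / (2 * \<epsilon>)))
        + \<epsilon> / 2 * ln (cosh ((v - u) * (v - u) / (2 * \<epsilon>))) + \<epsilon> / 2 * ln (cosh ((q - p) * (q - p) / (2 * \<epsilon>))))"
    if "u \<in> X" "v \<in> X" "p \<in> X" "q \<in> X" for u v p q
  proof -
    have "ereal (d + e + f - \<epsilon> * l1) - ereal (1/2) * ereal ((g - g)\<^sup>2 + e + e - \<epsilon> * l2)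
        - ereal (1/2) * ereal ((h - h)\<^sup>2 + f + f - \<epsilon> * l3) = ereal (d - \<epsilon> * l1 + \<epsilon> / 2 * l2 + \<epsilon> / 2 * l3)"
      for d e f g h l1 l2 l3
      by (simp add: field_simps)
    with that show ?thesis
      unfolding sinkhorn_divergence_def by (simp only: OT_two_point[OF assms(1) id id] \<open>space M = X\<close>)
  qed
  have dirac: "two_point M u u \<in> borel_prob_measures X" if "u \<in> X" for u
    using that prob_space_two_point[of u M u] by (simp add: borel_prob_measures_def) (simp add: M_def)
  have "?S (mix_measure (1/2) (two_point M a a) (two_point M b b)) (mix_measure (1/2) (two_point M c c) (two_point M b b))
      \<le> ereal (1 - 1/2) * ?S (two_point M a a) (two_point M c c) + ereal (1/2) * ?S (two_point M b b) (two_point M b b)"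
    using ab c by (intro conv[unfolded jointly_convex_on_def, rule_format] dirac) auto
  then have "?S (two_point M a b) (two_point M c b)
      \<le> ereal (1 - 1/2) * ?S (two_point M a a) (two_point M c c) + ereal (1/2) * ?S (two_point M b b) (two_point M b b)"
    using ab c by (simp only: mix_two_point \<open>space M = X\<close>)
  moreover have "ereal (1 - 1/2) * ereal s + ereal (1/2) * ereal t = ereal ((s + t) / 2)" for s t
    by (simp add: field_simps)
  \<comment> \<open>On the right, the Dirac pair at \<open>a\<close>, \<open>c\<close> contributes
    \<open>(a - c)\<^sup>2\<close> and the pair at \<open>b\<close>, \<open>b\<close> contributes
    0.\<close>
  ultimately have le: "((a + b) / 2 - (c + b) / 2)\<^sup>2 - \<epsilon> * ln (cosh ((b - a) * (b - c) / (2 * \<epsilon>)))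
        + \<epsilon> / 2 * ln (cosh ((b - a) * (b - a) / (2 * \<epsilon>))) + \<epsilon> / 2 * ln (cosh ((b - c) * (b - c) / (2 * \<epsilon>)))
      \<le> (a - c)\<^sup>2 / 2"
    using ab c by (simp only: S ereal_less_eq) simp
  have ln_cosh: "ln (cosh v) = v - ln 2 + ln (1 + exp (- 2 * v))" for v :: real
  proof -
    have "cosh v = exp v / 2 * (1 + exp (- 2 * v))"
      by (simp add: cosh_field_def field_simps flip: exp_add)
    then show ?thesis
      using exp_gt_zero[of "- 2 * v"] by (simp only:) (subst ln_mult, auto simp: ln_div add_pos_pos)
  qed
  \<comment> \<open>This scaling turns the arguments of \<open>cosh\<close> into
    \<open>x * y\<close>, \<open>x\<^sup>2\<close>, \<open>y\<^sup>2\<close> and the threshold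
    \<open>?r\<close> into 1.\<close>
  define x y where "x = (b - a) / ?r" and "y = (b - c) / ?r"
  have xy: "1 < x" "1 < y" "x \<noteq> y"
    using ab c r by (auto simp: x_def y_def)
  have "2 * ln (1 + exp (- 2 * (x * y))) < ln (1 + exp (- 2 * x\<^sup>2)) + ln (1 + exp (- 2 * y\<^sup>2))"
    using ln_one_plus_exp_geometric_mean[of x y] ln_one_plus_exp_geometric_mean[of y x] xy
    by (cases "x < y") (auto simp: mult.commute)
  \<comment> \<open>In \<open>ln_cosh\<close> the constants \<open>ln 2\<close> cancel, and the
    linear terms combine to \<open>(x - y)\<^sup>2\<close>.\<close>
  then have "2 * ln (cosh (x * y)) + (x - y)\<^sup>2 < ln (cosh (x\<^sup>2)) + ln (cosh (y\<^sup>2))"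
    unfolding ln_cosh by (simp add: power2_eq_square algebra_simps)
  then have "\<epsilon> / 2 * (2 * ln (cosh (x * y)) + (x - y)\<^sup>2) < \<epsilon> / 2 * (ln (cosh (x\<^sup>2)) + ln (cosh (y\<^sup>2)))"
    using assms(1) by (intro mult_strict_left_mono) auto
  moreover have "x * y = (b - a) * (b - c) / (2 * \<epsilon>)" "x\<^sup>2 = (b - a) * (b - a) / (2 * \<epsilon>)"
      "y\<^sup>2 = (b - c) * (b - c) / (2 * \<epsilon>)"
    using assms(1) by (simp_all add: x_def y_def power2_eq_square)
  moreover have "x - y = (c - a) / ?r"
    by (simp add: x_def y_def flip: diff_divide_distrib)
  \<comment> \<open>This quarter of \<open>(a - c)\<^sup>2\<close> and the quarter from the distance
    of the means add up to the right side of \<open>le\<close>, which the strict inequality then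
    contradicts.\<close>
  then have "\<epsilon> / 2 * (x - y)\<^sup>2 = (a - c)\<^sup>2 / 4"
    using assms(1) by (simp add: power_divide power2_commute[of c a])
  moreover have "((a + b) / 2 - (c + b) / 2)\<^sup>2 = (a - c)\<^sup>2 / 4"
    by (simp add: power2_eq_square field_simps)
  ultimately show False
    using le by (simp only: distrib_left)
qed

end
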